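(* Let $k\geq 3$ be an integer. Suppose that an integer $n\equiv 0 \pmod{2^{k-1}(2^k-1)^2}$ cannot be represented as the sum of an integer in $\mathcal{N}_k$ and at most $k$ powers of $2$. Then, for every integer $a\geq 0$, the integer $2^a n$ also cannot be represented as the sum of an integer in $\mathcal{N}_k$ and at most $k$ powers of $2$.
   Context: $\mathcal{N}_k$ denotes the set of integers that are norms of ideals in $\mathbb{Z}[\exp(2\pi i/2^k)]$, where the norm of a nonzero ideal $I$ is the index $|\mathbb{Z}[\exp(2\pi i/2^k)]/I|$ and the zero ideal has norm $0$. A power of $2$ means $2^b$ with $b\geq 0$ an integer (so $1$ is a power of $2$). An integer $n$ is the sum of an integer in $\mathcal{N}_k$ and at most $k$ powers of $2$ if $n=m+2^{b_1}+\cdots+2^{b_j}$ for some $m\in\mathcal{N}_k$, some $0\le j\le k$ and some integers $b_1,\dots,b_j\ge 0$, not necessarily distinct. *)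

theory Defs
  imports
    Complex_Main
    "HOL-Number_Theory.Cong"
    "HOL-Algebra.QuotRing"
    "HOL-Algebra.Generated_Rings"
    "HOL-Algebra.Algebraic_Closure_Type"
begin

definition cyclotomic_ring :: "nat \<Rightarrow> complex ring" where
  "cyclotomic_ring k =
     (ring_of_type_algebra :: complex ring)
       \<lparr>carrier := generate_ring ring_of_type_algebra {exp (2 * complex_of_real pi * \<i> / 2 ^ k)}\<rparr>"

definition ideal_norm :: "('a, 'b) ring_scheme \<Rightarrow> 'a set \<Rightarrow> int" where
  "ideal_norm R I = (if I = {\<zero>\<^bsub>R\<^esub>} then 0 else int (card (carrier (R Quot I))))"

definition ideal_norms :: "nat \<Rightarrow> int set" where
  "ideal_norms k = {ideal_norm (cyclotomic_ring k) I | I. ideal I (cyclotomic_ring k)}"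

text \<open>The list contains the exponents, so repeated powers are allowed and the list may be empty.\<close>

definition norm_plus_powers :: "nat \<Rightarrow> int \<Rightarrow> bool" where
  "norm_plus_powers k n \<longleftrightarrow>
     (\<exists>m \<in> ideal_norms k. \<exists>bs :: nat list. length bs \<le> k \<and> n = m + (\<Sum>b\<leftarrow>bs. 2 ^ b))"

end

theory Submission
  imports Defs "HOL-Algebra.Sylow" "HOL-Algebra.Multiplicative_Group"
begin

text \<open>
  It suffices to pass from \<open>2 n = m + \<Sum> 2 ^ b\<^sub>i\<close> to a representation of \<open>n\<close>. If \<open>m\<close> is even, then
  \<open>m / 2\<close> is again an ideal norm: an ideal of even index can be enlarged by an element killed
  modulo the ideal by the prime \<open>1 - \<zeta>\<close> of residue field of order \<open>2\<close>; and the powers of two can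
  be halved after merging pairs of ones. If \<open>m\<close> is odd, multiplication by \<open>\<zeta>\<close> acts freely on the
  nonzero elements of the quotient ring, so \<open>m \<equiv> 1\<close> modulo \<open>2 ^ k\<close>, and likewise every divisor \<open>u\<close>
  of \<open>m\<close> coprime to \<open>m / u\<close> is \<open>1\<close> modulo \<open>2 ^ k\<close> (act on the \<open>u\<close>-torsion). The powers of two then
  sum to \<open>-1\<close> modulo \<open>2 ^ k\<close>, which for at most \<open>k\<close> of them forces the sum \<open>u = 2 ^ k - 1\<close>. As
  \<open>u\<^sup>2\<close> divides \<open>n\<close>, the cofactor \<open>m / u\<close> is \<open>-1\<close> modulo \<open>u\<close>, so \<open>u \<equiv> 1\<close> modulo \<open>2 ^ k\<close>, a contradiction.
\<close>

section \<open>Finite groups\<close>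

text \<open>Cauchy's theorem, as the Sylow existence theorem with exponent 1: a subgroup of order
  \<open>p\<close> has a nontrivial element, and by Lagrange the power \<open>p\<close> kills
  it.\<close>

lemma (in group) cauchy:
  assumes fin: "finite (carrier G)" and p: "Factorial_Ring.prime (p::nat)" and dvd: "p dvd Coset.order G"
  shows "\<exists>x\<in>carrier G. x \<noteq> \<one> \<and> x [^] p = \<one>"
proof -
  obtain m where m: "Coset.order G = p ^ 1 * m" using dvd by auto
  obtain H where H: "subgroup H G" "card H = p ^ 1"
    using sylow_thm[OF p is_group m fin] by blast
  have "card H > 1" using H p prime_gt_1_nat by simp
  then have "\<not> H \<subseteq> {\<one>}" using card_mono[of "{\<one>}" H] by auto
  then obtain x where x: "x \<in> H" "x \<noteq> \<one>" by blast
  interpret H: group "G\<lparr>carrier := H\<rparr>" using H(1) by (rule subgroup_imp_group)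
  have "x [^]\<^bsub>G\<lparr>carrier := H\<rparr>\<^esub> Coset.order (G\<lparr>carrier := H\<rparr>) = \<one>"
    using H.pow_order_eq_1[of x] x by simp
  then have "x [^] p = \<one>" using H(2) by (simp add: Coset.order_def nat_pow_consistent[symmetric])
  then show ?thesis using x subgroup.mem_carrier[OF H(1)] by blast
qed

lemma (in group) coprime_pow_eq_one:
  assumes "x \<in> carrier G" "x [^] (a::nat) = \<one>" "x [^] b = \<one>" "coprime a b"
  shows "x = \<one>"
proof -
  have "ord x dvd a" "ord x dvd b" using assms pow_eq_id by blast+
  then have "ord x = 1" using assms(4) coprime_common_divisor_nat by blast
  then show ?thesis using assms(1) ord_eq_1 by blast
qed

text \<open>By Cauchy, a prime \<open>p\<close> dividing both \<open>card H\<close> and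
  \<open>b\<close> would give a nontrivial \<open>x\<close> in \<open>H\<close> killed by
  \<open>p\<close> and by \<open>a\<close>, although \<open>a\<close> and \<open>p\<close> are
  coprime.\<close>

lemma (in group) coprime_card_if_pow_eq_one:
  assumes fin: "finite (carrier G)" and H: "subgroup H G"
    and e: "\<And>x. x \<in> H \<Longrightarrow> x [^] (a::nat) = \<one>" and cop: "coprime a b"
  shows "coprime (card H) b"
proof (rule ccontr)
  assume "\<not> coprime (card H) b"
  then obtain p where p: "Factorial_Ring.prime p" "p dvd card H" "p dvd b"
    using prime_factor_nat[of "gcd (card H) b"] by (auto simp: coprime_iff_gcd_eq_1)
  interpret H: group "G\<lparr>carrier := H\<rparr>" using H by (rule subgroup_imp_group)
  have "finite H" using fin H finite_subset subgroup.subset by blast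
  then have "\<exists>x\<in>carrier (G\<lparr>carrier := H\<rparr>). x \<noteq> \<one>\<^bsub>G\<lparr>carrier := H\<rparr>\<^esub>
      \<and> x [^]\<^bsub>G\<lparr>carrier := H\<rparr>\<^esub> p = \<one>\<^bsub>G\<lparr>carrier := H\<rparr>\<^esub>"
    using p(2) by (intro H.cauchy p(1)) (simp_all add: Coset.order_def)
  then obtain x where x: "x \<in> H" "x \<noteq> \<one>" "x [^] p = \<one>"
    unfolding nat_pow_consistent[symmetric] by auto
  have "coprime a p" using coprime_divisors[OF dvd_refl p(3) cop] .
  then show False
    using coprime_pow_eq_one[of x a p] x e[of x] subgroup.mem_carrier[OF H] by blast
qed

text \<open>The \<open>u\<close>-torsion is the kernel of the power map \<open>x [^] u\<close>. The
  kernel is killed by \<open>u\<close>, so its order is coprime to \<open>c\<close>; the image is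
  killed by \<open>c\<close>, so its order is coprime to \<open>u\<close>. The two orders multiply
  to \<open>u * c\<close>, which leaves \<open>u\<close> for the kernel.\<close>

lemma (in comm_group) card_torsion_coprime:
  assumes fin: "finite (carrier G)" and ord: "Coset.order G = u * c" and cop: "coprime u c"
  shows "card {x \<in> carrier G. x [^] u = \<one>} = u"
proof -
  let ?f = "\<lambda>x. x [^] u"
  let ?K = "kernel G G ?f" and ?L = "?f ` carrier G"
  interpret f: group_hom G G ?f
    by unfold_locales (auto simp: hom_def nat_pow_distrib)
  have "card (rcosets ?K) = card ?L"
  proof -
    interpret L: group "G\<lparr>carrier := ?L\<rparr>" by (rule subgroup_imp_group) (rule f.img_is_subgroup)
    interpret h: group_hom G "G\<lparr>carrier := ?L\<rparr>" ?f
      by unfold_locales (auto simp: hom_def nat_pow_distrib)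
    show ?thesis using h.FactGroup_iso[THEN iso_same_card] by (simp add: FactGroup_def kernel_def)
  qed
  have K: "coprime (card ?K) c"
    by (rule coprime_card_if_pow_eq_one[OF fin f.subgroup_kernel _ cop]) (simp add: kernel_def)
  have L: "coprime (card ?L) u"
  proof (rule coprime_card_if_pow_eq_one[OF fin f.img_is_subgroup])
    fix x assume "x \<in> ?L"
    then show "x [^] c = \<one>" using pow_order_eq_1 ord by (auto simp: nat_pow_pow)
  qed (use cop in \<open>simp add: coprime_commute\<close>)
  have prod: "card ?L * card ?K = u * c"
    using lagrange[OF f.subgroup_kernel] ord \<open>card (rcosets ?K) = card ?L\<close> by simp
  have "card ?K dvd u * c" unfolding prod[symmetric] by simp
  then have Ku: "card ?K dvd u" using K coprime_dvd_mult_left_iff by blast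
  have "u dvd card ?L * card ?K" unfolding prod by simp
  then have "u dvd card ?K" using L coprime_dvd_mult_right_iff coprime_commute by blast
  with Ku have "card ?K = u" by (rule dvd_antisym)
  then show ?thesis by (simp add: kernel_def)
qed

section \<open>Free actions of a cyclic group of order a power of two\<close>

lemma funpow_mult_fixed:
  assumes "(f ^^ a) x = x" shows "(f ^^ (a * n)) x = x"
  using assms funpow_mod_eq[of a f x "a * n"] by simp

text \<open>Bezout over the naturals: \<open>a * m = b * n + gcd a b\<close>, and iterating
  \<open>a * m\<close> or \<open>b * n\<close> times fixes \<open>x\<close>.\<close>

lemma funpow_gcd_fixed:
  assumes "(f ^^ a) x = x" "(f ^^ b) x = x"
  shows "(f ^^ gcd a b) x = x"
proof (cases "a = 0")
  case False
  then obtain m n where "a * m = b * n + gcd a b" using bezout_nat by blast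
  then have "gcd a b + b * n = a * m" by simp
  then have "(f ^^ (gcd a b + b * n)) x = x" using funpow_mult_fixed[OF assms(1)] by simp
  then show ?thesis using funpow_mult_fixed[OF assms(2)] by (simp add: funpow_add)
qed (use assms in simp)

text \<open>The orbits partition \<open>A\<close>, and each has exactly \<open>2 ^ Suc j\<close>
  elements.\<close>

lemma dvd_card_if_free_action:
  fixes f :: "'a \<Rightarrow> 'a"
  assumes fin: "finite A" and f: "\<And>x. x \<in> A \<Longrightarrow> f x \<in> A"
    and per: "\<And>x. x \<in> A \<Longrightarrow> (f ^^ (2 ^ Suc j)) x = x"
    and free: "\<And>x. x \<in> A \<Longrightarrow> (f ^^ (2 ^ j)) x \<noteq> x"
  shows "2 ^ Suc j dvd card A"
proof -
  define N :: nat where "N = 2 ^ Suc j"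
  define orb where "orb x = (\<lambda>i. (f ^^ i) x) ` {..<N}" for x
  have N0: "N > 0" by (simp add: N_def)
  have A: "(f ^^ i) x \<in> A" if "x \<in> A" for x i using that f by (induction i) auto
  \<comment> \<open>Excluding the half period \<open>2 ^ j\<close> excludes every smaller period: a
    period \<open>e < N\<close> yields the period \<open>gcd e N\<close>, a proper divisor of the
    power of two \<open>N\<close>, hence a divisor of \<open>2 ^ j\<close>.\<close>
  have free': "(f ^^ e) y \<noteq> y" if y: "y \<in> A" and e: "0 < e" "e < N" for y e
  proof
    assume "(f ^^ e) y = y"
    from this per[OF y, folded N_def] have g: "(f ^^ gcd e N) y = y" by (rule funpow_gcd_fixed)
    obtain i where i: "i \<le> Suc j" "gcd e N = 2 ^ i"
      using divides_primepow_nat[of 2 "gcd e N" "Suc j"] by (auto simp: N_def)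
    have "gcd e N \<le> e" using e by (simp add: gcd_le1_nat)
    then have "2 ^ i \<noteq> N" using i(2) e(2) by simp
    then have "i \<noteq> Suc j" unfolding N_def by blast
    then have "gcd e N dvd 2 ^ j" using i by (simp add: le_imp_power_dvd)
    then obtain n where "2 ^ j = gcd e N * n" by (rule dvdE)
    then have "(f ^^ (2 ^ j)) y = y" using funpow_mult_fixed[OF g] by simp
    then show False using free y by blast
  qed
  have inj: "inj_on (\<lambda>i. (f ^^ i) x) {..<N}" if x: "x \<in> A" for x
  proof (rule linorder_inj_onI')
    fix i i' assume "i \<in> {..<N}" "i' \<in> {..<N}" "i < i'"
    then have "(f ^^ (i' - i)) ((f ^^ i) x) \<noteq> (f ^^ i) x" using free' A x by simp
    moreover have "(f ^^ i') x = (f ^^ (i' - i)) ((f ^^ i) x)"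
      using \<open>i < i'\<close> by (metis comp_apply funpow_add le_add_diff_inverse2 less_imp_le)
    ultimately show "(f ^^ i) x \<noteq> (f ^^ i') x" by simp
  qed
  have orb_all: "(f ^^ i) x \<in> orb x" if "x \<in> A" for x i
    using funpow_mod_eq[OF per[OF that], of i] N0 by (auto simp: orb_def N_def intro!: image_eqI[of _ _ "i mod N"])
  have orb_sub: "orb y \<subseteq> orb x" if x: "x \<in> A" and y: "y \<in> orb x" for x y
  proof -
    obtain i where "y = (f ^^ i) x" using y by (auto simp: orb_def)
    then have "(f ^^ n) y = (f ^^ (n + i)) x" for n by (simp add: funpow_add)
    then show ?thesis using orb_all[OF x] unfolding orb_def[of y] by auto
  qed
  \<comment> \<open>From \<open>y\<close>, reached after \<open>i\<close> steps, another
    \<open>N - i\<close> steps lead back to \<open>x\<close>.\<close>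
  have orb_sym: "x \<in> orb y" if x: "x \<in> A" and y: "y \<in> orb x" for x y
  proof -
    obtain i where i: "i < N" "y = (f ^^ i) x" using y by (auto simp: orb_def)
    then have "(f ^^ (N - i)) y = (f ^^ N) x"
      by (metis comp_apply funpow_add le_add_diff_inverse2 less_imp_le)
    then have "(f ^^ (N - i)) y = x" using per[OF x] by (simp add: N_def)
    moreover have "y \<in> A" using i A x by simp
    ultimately show ?thesis using orb_all by metis
  qed
  have orb_A: "orb x \<subseteq> A" if "x \<in> A" for x using A that by (auto simp: orb_def)
  have U: "\<Union>(orb ` A) = A" using orb_A orb_all[of _ 0] by fastforce
  have "N dvd card (\<Union>(orb ` A))"
  proof (rule dvd_partition)
    show "finite (\<Union>(orb ` A))" using U fin by simp
    show "\<forall>c\<in>orb ` A. N dvd card c" using inj by (auto simp: orb_def card_image)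
    show "\<forall>c1\<in>orb ` A. \<forall>c2\<in>orb ` A. c1 \<noteq> c2 \<longrightarrow> c1 \<inter> c2 = {}"
    proof (clarsimp, rule ccontr)
      fix x y assume xy: "x \<in> A" "y \<in> A" "orb x \<noteq> orb y" "orb x \<inter> orb y \<noteq> {}"
      then obtain w where w: "w \<in> orb x" "w \<in> orb y" by blast
      then have "w \<in> A" using orb_A xy by blast
      then have "orb x = orb w" "orb y = orb w" using w xy orb_sub orb_sym by blast+
      then show False using xy by simp
    qed
  qed
  then show ?thesis using U by (simp add: N_def)
qed

text \<open>Multiplication by \<open>z\<close> acts on the nonzero elements of \<open>T\<close>. Its
  iterate \<open>2 ^ j\<close> is negation, which fixes no nonzero element of a ring of odd order,
  so all orbits have length \<open>2 ^ Suc j\<close>; the 1 counts the zero element.\<close>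

lemma (in ring) card_cong_1_if_stable:
  assumes odd: "odd (card (carrier R))"
    and z: "z \<in> carrier R" "z [^] (2 ^ j :: nat) = \<ominus> \<one>"
    and T: "T \<subseteq> carrier R" "\<zero> \<in> T" "\<And>x. x \<in> T \<Longrightarrow> z \<otimes> x \<in> T"
  shows "[card T = 1] (mod 2 ^ Suc j)"
proof -
  \<comment> \<open>An infinite set has \<open>card\<close> equal to 0, which is even, so oddness
    already gives finiteness.\<close>
  have fin: "finite (carrier R)" using odd card_ge_0_finite odd_pos by blast
  have pow: "((\<lambda>x. z \<otimes> x) ^^ i) x = z [^] i \<otimes> x" if "x \<in> carrier R" for i x
  proof (induction i)
    case (Suc i)
    then show ?case using that z(1) by (simp add: m_assoc[symmetric] nat_pow_Suc2[symmetric])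
  qed (use that in simp)
  have half: "((\<lambda>x. z \<otimes> x) ^^ (2 ^ j)) x = \<ominus> x" if "x \<in> carrier R" for x
    using pow[OF that] z that by (simp add: l_minus)
  have "2 ^ Suc j dvd card (T - {\<zero>})"
  proof (rule dvd_card_if_free_action)
    show "finite (T - {\<zero>})" using T fin finite_subset by blast
  next
    fix x assume x: "x \<in> T - {\<zero>}"
    then have xc: "x \<in> carrier R" using T by blast
    show per: "((\<lambda>x. z \<otimes> x) ^^ (2 ^ Suc j)) x = x"
      using half[OF xc] half[of "\<ominus> x"] xc by (simp add: mult_2 funpow_add)
    show "((\<lambda>x. z \<otimes> x) ^^ (2 ^ j)) x \<noteq> x"
    proof
      assume "((\<lambda>x. z \<otimes> x) ^^ (2 ^ j)) x = x"
      then have "\<ominus> x = x" using half[OF xc] by simp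
      then have "x \<oplus> x = \<zero>" using xc r_neg by metis
      then have "add_pow R (2::nat) x = \<zero>" using xc by (simp add: numeral_2_eq_2)
      moreover have "add_pow R (card (carrier R)) x = \<zero>"
        using add.pow_order_eq_1[of x] xc by (simp add: Coset.order_def)
      ultimately have "x = \<zero>"
        using add.coprime_pow_eq_one[of x 2 "card (carrier R)"] xc odd by (simp add: add_pow_def)
      then show False using x by simp
    qed
    show "z \<otimes> x \<in> T - {\<zero>}"
    proof -
      have "z \<otimes> x \<noteq> \<zero>"
      proof
        assume z0: "z \<otimes> x = \<zero>"
        have "((\<lambda>x. z \<otimes> x) ^^ (2 ^ Suc j)) x = ((\<lambda>x. z \<otimes> x) ^^ (2 ^ Suc j - 1)) (z \<otimes> x)"
          by (metis One_nat_def Suc_pred comp_apply funpow_Suc_right pos2 zero_less_power)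
        also have "\<dots> = \<zero>" using z0 pow[of \<zero>] z(1) by simp
        finally show False using per x by simp
      qed
      then show ?thesis using T x by blast
    qed
  qed
  then have "[card (T - {\<zero>}) + 1 = 0 + 1] (mod 2 ^ Suc j)"
    using cong_0_iff cong_add_rcancel_nat by blast
  moreover have "card T = card (T - {\<zero>}) + 1"
    using T finite_subset[OF _ fin] card.remove[of T \<zero>] by simp
  ultimately show ?thesis by simp
qed

text \<open>The additive \<open>u\<close>-torsion has exactly \<open>u\<close> elements and is
  stable under multiplication by \<open>z\<close>, so the count of free orbits applies to
  it.\<close>

lemma (in cring) card_torsion_cong_1:
  assumes ord: "card (carrier R) = u * c" and cop: "coprime u c" and odd: "odd (u * c)"
    and z: "z \<in> carrier R" "z [^] (2 ^ j :: nat) = \<ominus> \<one>"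
  shows "[u = 1] (mod 2 ^ Suc j)"
proof -
  let ?T = "{x \<in> carrier R. add_pow R u x = \<zero>}"
  have fin: "finite (carrier R)" using odd ord card_ge_0_finite odd_pos by metis
  have "card ?T = u"
    using add.card_torsion_coprime[of u c] fin ord cop by (simp add: Coset.order_def add_pow_def)
  moreover have "[card ?T = 1] (mod 2 ^ Suc j)"
  proof (rule card_cong_1_if_stable[OF _ z])
    fix x assume "x \<in> ?T"
    then show "z \<otimes> x \<in> ?T" using z(1) add_pow_rdistr[of z x u] by auto
  qed (use ord odd in auto)
  ultimately show ?thesis by simp
qed

section \<open>Halving an ideal norm\<close>

text \<open>\<open>J\<close> is the kernel of the composite of the projections to
  \<open>R Quot I\<close> and to its quotient by \<open>K\<close>. Thus \<open>R Quot J\<close> is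
  isomorphic to that second quotient, whose order Lagrange gives.\<close>

lemma (in ideal) quotient_ideal_contract:
  assumes K: "ideal K (R Quot I)" and fin: "finite (carrier (R Quot I))"
  shows "\<exists>J. ideal J R \<and> I \<subseteq> J \<and>
    card (carrier (R Quot J)) * card K = card (carrier (R Quot I))"
proof -
  let ?S = "R Quot I"
  let ?h = "(+>\<^bsub>?S\<^esub>) K \<circ> (+>) I"
  let ?J = "a_kernel R (?S Quot K) ?h"
  interpret S: ring ?S by (rule quotient_is_ring)
  interpret K: ideal K ?S by (rule K)
  interpret KQ: ring "?S Quot K" by (rule K.quotient_is_ring)
  have h: "?h \<in> ring_hom R (?S Quot K)"
    using ring_hom_trans[OF rcos_ring_hom K.rcos_ring_hom] .
  interpret h: ring_hom_ring R "?S Quot K" ?h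
    by (rule ring_hom_ringI2[OF local.ring_axioms K.quotient_is_ring h])
  have carS: "carrier ?S = (\<lambda>x. I +> x) ` carrier R"
    by (auto simp: FactRing_def A_RCOSETS_def')
  have carK: "carrier (?S Quot K) = (\<lambda>x. K +>\<^bsub>?S\<^esub> x) ` carrier ?S"
    by (auto simp: FactRing_def[of ?S] A_RCOSETS_def')
  have "?h ` carrier R = carrier (?S Quot K)"
    unfolding carK carS by auto
  then have "R Quot ?J \<simeq> ?S Quot K" by (rule h.FactRing_iso)
  then have "card (carrier (R Quot ?J)) = card (carrier (?S Quot K))"
    by (rule ring_iso_same_card)
  also have "\<dots> * card K = card (carrier ?S)"
    using S.a_lagrange[OF fin K.is_additive_subgroup] by (simp add: FactRing_def[of ?S] Coset.order_def)
  finally have "card (carrier (R Quot ?J)) * card K = card (carrier ?S)" .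
  moreover have "I \<subseteq> ?J"
    using a_rcos_const a_Hcarr K.a_rcos_const[OF K.zero_closed]
    by (auto simp: a_kernel_def' FactRing_def)
  ultimately show ?thesis using h.kernel_is_ideal by blast
qed

text \<open>By \<open>gen\<close> every \<open>s\<close> is 0 or 1 modulo \<open>l\<close>. Since
  \<open>l\<close> kills \<open>y\<close>, the product of \<open>s\<close> and \<open>y\<close>
  depends only on this residue and is zero or \<open>y\<close>.\<close>

lemma (in cring) pair_ideal:
  assumes l: "l \<in> carrier R"
    and gen: "\<And>s. s \<in> carrier R \<Longrightarrow> \<exists>t\<in>carrier R. s = l \<otimes> t \<or> s = \<one> \<oplus> l \<otimes> t"
    and y: "y \<in> carrier R" "l \<otimes> y = \<zero>"
  shows "ideal {\<zero>, y} R"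
proof -
  have ly: "(l \<otimes> t) \<otimes> y = \<zero>" if "t \<in> carrier R" for t
    using that l y by (metis m_assoc m_comm r_null)
  have act: "s \<otimes> y \<in> {\<zero>, y}" if s: "s \<in> carrier R" for s
  proof -
    obtain t where t: "t \<in> carrier R" "s = l \<otimes> t \<or> s = \<one> \<oplus> l \<otimes> t" using gen[OF s] by blast
    then show ?thesis using ly[of t] l y by (auto simp: l_distr)
  qed
  \<comment> \<open>Closure under the additive operations follows from multiplication by -1 and by 1
    + 1.\<close>
  have neg: "\<ominus> y \<in> {\<zero>, y}" using act[of "\<ominus> \<one>"] y by (simp add: l_minus)
  have dbl: "y \<oplus> y \<in> {\<zero>, y}" using act[of "\<one> \<oplus> \<one>"] y by (simp add: l_distr)
  show ?thesis
  proof (rule idealI[OF ring_axioms])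
    show "subgroup {\<zero>, y} (add_monoid R)"
    proof (rule add.subgroupI)
      fix a assume "a \<in> {\<zero>, y}"
      then show "\<ominus> a \<in> {\<zero>, y}" using neg by auto
    next
      fix a b assume "a \<in> {\<zero>, y}" "b \<in> {\<zero>, y}"
      then show "a \<oplus> b \<in> {\<zero>, y}" using dbl y by auto
    qed (use y in auto)
  next
    fix a x assume a: "a \<in> {\<zero>, y}" and x: "x \<in> carrier R"
    then show "x \<otimes> a \<in> {\<zero>, y}" using act by auto
    then show "a \<otimes> x \<in> {\<zero>, y}" using a x y m_comm by auto
  qed
qed

text \<open>Cauchy gives \<open>x\<close> of additive order 2, and \<open>l [^] d\<close>, being a
  double, kills it. The last nonzero term of \<open>x\<close>, \<open>l x\<close>,
  \<open>l^2 x\<close>, ... is killed by \<open>l\<close> and spans an ideal with two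
  elements.\<close>

lemma (in cring) exists_ideal_card_2:
  assumes fin: "finite (carrier R)" and even: "even (card (carrier R))"
    and l: "l \<in> carrier R"
    and gen: "\<And>s. s \<in> carrier R \<Longrightarrow> \<exists>t\<in>carrier R. s = l \<otimes> t \<or> s = \<one> \<oplus> l \<otimes> t"
    and dbl: "\<exists>s\<in>carrier R. l [^] (d::nat) = s \<oplus> s"
  shows "\<exists>K. ideal K R \<and> card K = 2"
proof -
  obtain s where s: "s \<in> carrier R" "l [^] d = s \<oplus> s" using dbl by blast
  obtain x where x: "x \<in> carrier R" "x \<noteq> \<zero>" "add_pow R (2::nat) x = \<zero>"
    using add.cauchy[of 2] fin even by (auto simp: Coset.order_def add_pow_def)
  have x2: "x \<oplus> x = \<zero>" using x by (simp add: numeral_2_eq_2)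
  have "(s \<oplus> s) \<otimes> x = s \<otimes> (x \<oplus> x)" using s x by (simp add: l_distr r_distr)
  then have ld: "l [^] d \<otimes> x = \<zero>" using s x2 by simp
  define i where "i = (LEAST i. l [^] (i::nat) \<otimes> x = \<zero>)"
  have i: "l [^] i \<otimes> x = \<zero>" unfolding i_def by (rule LeastI[of _ d]) (rule ld)
  then have "i \<noteq> 0" using x by (intro notI) simp
  then obtain e where e: "i = Suc e" using not0_implies_Suc by blast
  let ?y = "l [^] e \<otimes> x"
  have y: "?y \<in> carrier R" using l x by simp
  have "?y \<noteq> \<zero>" using not_less_Least[of e "\<lambda>i. l [^] (i::nat) \<otimes> x = \<zero>"] e i_def by auto
  moreover have "l \<otimes> ?y = \<zero>" using i l x e by (metis m_assoc nat_pow_Suc2 nat_pow_closed)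
  ultimately have "ideal {\<zero>, ?y} R" "card {\<zero>, ?y} = 2"
    using pair_ideal[OF l gen y] by auto
  then show ?thesis by blast
qed


section \<open>The ring of cyclotomic integers\<close>

definition zeta :: "nat \<Rightarrow> complex" where
  "zeta k = exp (2 * complex_of_real pi * \<i> / 2 ^ k)"

lemma zeta_pow_half:
  assumes "k \<ge> 1"
  shows "zeta k ^ (2 ^ (k - 1)) = -1"
proof -
  have "(2::complex) ^ k = 2 * 2 ^ (k - 1)" using assms by (metis power_Suc Suc_diff_1 less_eq_Suc_le One_nat_def)
  then have "of_nat (2 ^ (k - 1)) * (2 * complex_of_real pi * \<i> / 2 ^ k) = complex_of_real pi * \<i>"
    by simp
  then have "zeta k ^ (2 ^ (k - 1)) = exp (complex_of_real pi * \<i>)"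
    unfolding zeta_def by (metis exp_of_nat_mult)
  then show ?thesis by (simp add: exp_pi_i)
qed

lemma cyclotomic_ring_cring: "cring (cyclotomic_ring k)"
proof -
  interpret K: cring "ring_of_type_algebra :: complex ring" by (rule cring_from_type_algebra)
  have "subring (generate_ring ring_of_type_algebra {zeta k}) (ring_of_type_algebra :: complex ring)"
    by (rule K.generate_ring_is_subring) (simp add: ring_of_type_algebra_def)
  then show ?thesis
    unfolding cyclotomic_ring_def zeta_def[symmetric]
    using K.subcring_iff K.subcringI' K.generate_ring_incl[of "{zeta k}"]
    by (simp add: ring_of_type_algebra_def)
qed

lemma cyclotomic_ring_simps [simp]:
  "x \<otimes>\<^bsub>cyclotomic_ring k\<^esub> y = x * y" "x \<oplus>\<^bsub>cyclotomic_ring k\<^esub> y = x + y"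
  "\<one>\<^bsub>cyclotomic_ring k\<^esub> = 1" "\<zero>\<^bsub>cyclotomic_ring k\<^esub> = 0"
  by (simp_all add: cyclotomic_ring_def ring_of_type_algebra_def)

lemma cyclotomic_ring_a_inv [simp]:
  assumes "x \<in> carrier (cyclotomic_ring k)"
  shows "\<ominus>\<^bsub>cyclotomic_ring k\<^esub> x = - x"
proof -
  interpret R: cring "cyclotomic_ring k" by (rule cyclotomic_ring_cring)
  show ?thesis using R.r_neg[OF assms] by (simp add: add_eq_0_iff)
qed

lemma cyclotomic_ring_nat_pow [simp]: "x [^]\<^bsub>cyclotomic_ring k\<^esub> (n::nat) = x ^ n"
  by (induction n) (simp_all add: mult.commute)

lemma cyclotomic_ring_closed [simp]:
  assumes "x \<in> carrier (cyclotomic_ring k)"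
  shows cyclotomic_ring_uminus_closed: "- x \<in> carrier (cyclotomic_ring k)"
    and "y \<in> carrier (cyclotomic_ring k) \<Longrightarrow> x + y \<in> carrier (cyclotomic_ring k)"
    and "y \<in> carrier (cyclotomic_ring k) \<Longrightarrow> x * y \<in> carrier (cyclotomic_ring k)"
    and cyclotomic_ring_diff_closed:
      "y \<in> carrier (cyclotomic_ring k) \<Longrightarrow> x - y \<in> carrier (cyclotomic_ring k)"
    and "x ^ n \<in> carrier (cyclotomic_ring k)"
proof -
  interpret R: cring "cyclotomic_ring k" by (rule cyclotomic_ring_cring)
  show "- x \<in> carrier (cyclotomic_ring k)" using R.a_inv_closed[of x] assms by simp
  show "x ^ n \<in> carrier (cyclotomic_ring k)" using R.nat_pow_closed[of x n] assms by simp
  assume y: "y \<in> carrier (cyclotomic_ring k)"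
  show "x + y \<in> carrier (cyclotomic_ring k)" using R.a_closed[of x y] assms y by simp
  show "x * y \<in> carrier (cyclotomic_ring k)" using R.m_closed[of x y] assms y by simp
  show "x - y \<in> carrier (cyclotomic_ring k)"
    using R.a_closed[of x "- y"] R.a_inv_closed[of y] assms y by simp
qed

lemma cyclotomic_ring_generators [simp]:
  "0 \<in> carrier (cyclotomic_ring k)" "1 \<in> carrier (cyclotomic_ring k)"
  "zeta k \<in> carrier (cyclotomic_ring k)"
proof -
  interpret R: cring "cyclotomic_ring k" by (rule cyclotomic_ring_cring)
  show "0 \<in> carrier (cyclotomic_ring k)" "1 \<in> carrier (cyclotomic_ring k)"
    using R.zero_closed R.one_closed by simp_all
  show "zeta k \<in> carrier (cyclotomic_ring k)"
    by (simp add: cyclotomic_ring_def zeta_def generate_ring.incl)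
qed

text \<open>Induction over \<open>generate_ring\<close>, with the operations of the ring record
  replaced by those of the complex numbers.\<close>

lemma cyclotomic_induct [consumes 1, case_names one zeta minus add mult]:
  assumes "x \<in> carrier (cyclotomic_ring k)" and "P 1" "P (zeta k)"
    and "\<And>x. x \<in> carrier (cyclotomic_ring k) \<Longrightarrow> P x \<Longrightarrow> P (- x)"
    and "\<And>x y. x \<in> carrier (cyclotomic_ring k) \<Longrightarrow> y \<in> carrier (cyclotomic_ring k) \<Longrightarrow>
      P x \<Longrightarrow> P y \<Longrightarrow> P (x + y)"
    and "\<And>x y. x \<in> carrier (cyclotomic_ring k) \<Longrightarrow> y \<in> carrier (cyclotomic_ring k) \<Longrightarrow>
      P x \<Longrightarrow> P y \<Longrightarrow> P (x * y)"
  shows "P x"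
proof -
  let ?K = "ring_of_type_algebra :: complex ring"
  interpret K: cring ?K by (rule cring_from_type_algebra)
  have car: "carrier (cyclotomic_ring k) = generate_ring ?K {zeta k}"
    by (simp add: cyclotomic_ring_def zeta_def)
  have neg: "\<ominus>\<^bsub>?K\<^esub> h = - h" for h
    using K.r_neg[of h] by (simp add: ring_of_type_algebra_def add_eq_0_iff)
  have "x \<in> generate_ring ?K {zeta k}" using assms(1) car by simp
  then show ?thesis
  proof (induction rule: generate_ring.induct)
    case (a_inv h)
    then show ?case using assms(4)[of h] car neg by simp
  qed (use assms car in \<open>auto simp: ring_of_type_algebra_def\<close>)
qed

text \<open>\<open>1 - zeta k\<close> divides every \<open>1 - zeta k ^ n\<close>, and for
  \<open>n = 2 ^ (k - 1)\<close> the latter is 1 - (-1) = 2.\<close>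

lemma one_minus_zeta_dvd_2:
  assumes "k \<ge> 1"
  shows "\<exists>t\<in>carrier (cyclotomic_ring k). 2 = (1 - zeta k) * t"
proof -
  have "\<exists>t\<in>carrier (cyclotomic_ring k). 1 - zeta k ^ n = (1 - zeta k) * t" for n
  proof (induction n)
    case (Suc n)
    then obtain t where "t \<in> carrier (cyclotomic_ring k)" "1 - zeta k ^ n = (1 - zeta k) * t" by blast
    moreover have "1 - zeta k ^ Suc n = (1 - zeta k) + zeta k * (1 - zeta k ^ n)"
      by (simp add: algebra_simps)
    ultimately have "1 - zeta k ^ Suc n = (1 - zeta k) * (1 + zeta k * t)"
      "1 + zeta k * t \<in> carrier (cyclotomic_ring k)"
      by (simp_all add: algebra_simps)
    then show ?case by blast
  qed (auto intro: bexI[of _ 0])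
  from this[of "2 ^ (k - 1)"] show ?thesis using zeta_pow_half[OF assms] by simp
qed

text \<open>The residue field at the ramified prime \<open>1 - \<zeta>\<close> has two elements.\<close>

lemma residue_one_minus_zeta:
  assumes "k \<ge> 1" "s \<in> carrier (cyclotomic_ring k)"
  shows "\<exists>t\<in>carrier (cyclotomic_ring k). s = (1 - zeta k) * t \<or> s = 1 + (1 - zeta k) * t"
  using assms(2)
proof (induction rule: cyclotomic_induct)
  case one
  show ?case by (rule bexI[of _ 0]) auto
next
  case zeta
  \<comment> \<open>The witness comes from \<open>zeta k = 1 + (1 - zeta k) * (-1)\<close>.\<close>
  show ?case by (rule bexI[of _ "-1"]) auto
next
  case (minus x)
  \<comment> \<open>The residue -1 has to be brought back to 1, a change by 2, which is the multiple
    \<open>d\<close> of \<open>1 - zeta k\<close>.\<close>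
  obtain d where d: "d \<in> carrier (cyclotomic_ring k)" "2 = (1 - zeta k) * d"
    using one_minus_zeta_dvd_2[OF assms(1)] by blast
  obtain t where t: "t \<in> carrier (cyclotomic_ring k)"
    "x = (1 - zeta k) * t \<or> x = 1 + (1 - zeta k) * t" using minus by blast
  have "- (1 + (1 - zeta k) * t) = 1 + ((1 - zeta k) * (- t) - 2)" by (simp add: algebra_simps)
  also have "\<dots> = 1 + (1 - zeta k) * (- t - d)" unfolding d(2) by (simp add: algebra_simps)
  finally have "- x = (1 - zeta k) * (- t) \<or> - x = 1 + (1 - zeta k) * (- t - d)"
    using t(2) by auto
  then show ?case using t(1) d(1) cyclotomic_ring_uminus_closed cyclotomic_ring_diff_closed by metis
next
  case (add x y)
  obtain d where d: "d \<in> carrier (cyclotomic_ring k)" "2 = (1 - zeta k) * d"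
    using one_minus_zeta_dvd_2[OF assms(1)] by blast
  obtain t where t: "t \<in> carrier (cyclotomic_ring k)"
    "x = (1 - zeta k) * t \<or> x = 1 + (1 - zeta k) * t" using add by blast
  obtain t' where t': "t' \<in> carrier (cyclotomic_ring k)"
    "y = (1 - zeta k) * t' \<or> y = 1 + (1 - zeta k) * t'" using add by blast
  have "(1 + (1 - zeta k) * t) + (1 + (1 - zeta k) * t') = 2 + (1 - zeta k) * (t + t')"
    by (simp add: algebra_simps)
  also have "\<dots> = (1 - zeta k) * (t + t' + d)" unfolding d(2) by (simp add: algebra_simps)
  finally have "x + y = (1 - zeta k) * (t + t') \<or> x + y = 1 + (1 - zeta k) * (t + t')
      \<or> x + y = (1 - zeta k) * (t + t' + d)"
    using t(2) t'(2) by (auto simp: distrib_left)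
  moreover have "t + t' \<in> carrier (cyclotomic_ring k)" "t + t' + d \<in> carrier (cyclotomic_ring k)"
    using t t' d by auto
  ultimately show ?case by blast
next
  case (mult x y)
  obtain t where t: "t \<in> carrier (cyclotomic_ring k)"
    "x = (1 - zeta k) * t \<or> x = 1 + (1 - zeta k) * t" using mult by blast
  obtain t' where t': "t' \<in> carrier (cyclotomic_ring k)"
    "y = (1 - zeta k) * t' \<or> y = 1 + (1 - zeta k) * t'" using mult by blast
  have e: "(1 + (1 - zeta k) * t) * (1 + (1 - zeta k) * t')
      = 1 + (1 - zeta k) * (t + t' + (1 - zeta k) * t * t')"
    by (simp add: algebra_simps)
  have "x * y = (1 - zeta k) * (t * y) \<or> x * y = (1 - zeta k) * (t' * x)
      \<or> x * y = 1 + (1 - zeta k) * (t + t' + (1 - zeta k) * t * t')"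
    using t(2) t'(2) e by (auto simp: mult_ac)
  moreover have "t * y \<in> carrier (cyclotomic_ring k)" "t' * x \<in> carrier (cyclotomic_ring k)"
    "t + t' + (1 - zeta k) * t * t' \<in> carrier (cyclotomic_ring k)"
    using t t' mult by auto
  ultimately show ?case by blast
qed

text \<open>Squaring is additive modulo 2, so \<open>(1 - zeta k) ^ (2 ^ j)\<close> is
  \<open>1 + zeta k ^ (2 ^ j)\<close> modulo 2, and this vanishes at
  \<open>j = k - 1\<close>.\<close>

lemma one_minus_zeta_power:
  assumes "k \<ge> 1"
  shows "\<exists>t\<in>carrier (cyclotomic_ring k). (1 - zeta k) ^ (2 ^ (k - 1)) = t + t"
proof -
  have "\<exists>t\<in>carrier (cyclotomic_ring k). (1 - zeta k) ^ (2 ^ j) = 1 + zeta k ^ (2 ^ j) + 2 * t" for j :: nat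
  proof (induction j)
    case 0
    show ?case by (rule bexI[of _ "- zeta k"]) auto
  next
    case (Suc j)
    then obtain t where t: "t \<in> carrier (cyclotomic_ring k)"
      "(1 - zeta k) ^ (2 ^ j) = 1 + zeta k ^ (2 ^ j) + 2 * t" by blast
    let ?w = "zeta k ^ (2 ^ j)"
    \<comment> \<open>Read off from expanding the square of \<open>1 + ?w + 2 * t\<close>;
      \<open>t + t\<close> in place of \<open>2 * t\<close> lets the closure rules apply.\<close>
    let ?t = "?w + (t + t) * (1 + ?w + t)"
    have "(1 - zeta k) ^ (2 ^ Suc j) = ((1 - zeta k) ^ (2 ^ j))\<^sup>2"
      by (simp add: power_mult[symmetric] mult.commute)
    also have "\<dots> = 1 + ?w\<^sup>2 + 2 * ?t"
      unfolding t(2) by (simp add: power2_eq_square algebra_simps)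
    also have "?w\<^sup>2 = zeta k ^ (2 ^ Suc j)" by (simp add: power_mult[symmetric] mult.commute)
    finally have "(1 - zeta k) ^ (2 ^ Suc j) = 1 + zeta k ^ (2 ^ Suc j) + 2 * ?t" .
    moreover have "?t \<in> carrier (cyclotomic_ring k)"
      by (intro cyclotomic_ring_closed cyclotomic_ring_generators t(1))
    ultimately show ?case by blast
  qed
  from this[of "k - 1"] obtain t where t: "t \<in> carrier (cyclotomic_ring k)"
    "(1 - zeta k) ^ (2 ^ (k - 1)) = 1 + zeta k ^ (2 ^ (k - 1)) + 2 * t" by blast
  have "(1 - zeta k) ^ (2 ^ (k - 1)) = t + t"
    unfolding t(2) zeta_pow_half[OF assms] by simp
  with t(1) show ?thesis by blast
qed

section \<open>Even and odd ideal norms of the cyclotomic ring\<close>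

text \<open>The image of \<open>1 - zeta k\<close> produces an ideal of order 2 in the quotient by
  \<open>I\<close>; its preimage \<open>J\<close> has half the index of \<open>I\<close>.\<close>

lemma even_ideal_norm_half:
  assumes k: "k \<ge> 1" and m: "m \<in> ideal_norms k" "even m"
  shows "m div 2 \<in> ideal_norms k"
proof (cases "m = 0")
  case False
  let ?R = "cyclotomic_ring k"
  obtain I where I: "ideal I ?R" "m = ideal_norm ?R I" using m by (auto simp: ideal_norms_def)
  let ?S = "?R Quot I"
  interpret R: cring ?R by (rule cyclotomic_ring_cring)
  interpret I: ideal I ?R by (rule I)
  interpret S: cring ?S by (rule I.quotient_is_cring) (rule R.cring_axioms)
  interpret h: ring_hom_ring ?R ?S "(+>\<^bsub>?R\<^esub>) I" by (rule I.rcos_ring_hom_ring)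
  have nz: "I \<noteq> {0}" and card: "m = int (card (carrier ?S))"
    using False I by (auto simp: ideal_norm_def split: if_splits)
  \<comment> \<open>An infinite quotient would have \<open>card\<close> 0, contrary to
    \<open>m\<close> being nonzero.\<close>
  have fin: "finite (carrier ?S)" using card False card.infinite by force
  let ?h = "(+>\<^bsub>?R\<^esub>) I"
  have surj: "\<exists>x\<in>carrier ?R. s = ?h x" if "s \<in> carrier ?S" for s
    using that by (auto simp: FactRing_def A_RCOSETS_def')
  have "\<exists>K. ideal K ?S \<and> card K = 2"
  proof (rule S.exists_ideal_card_2[OF fin])
    show "even (card (carrier ?S))" using card m by simp
    show "?h (1 - zeta k) \<in> carrier ?S" by (rule h.hom_closed) simp
  next
    fix s assume "s \<in> carrier ?S"
    then obtain x where x: "x \<in> carrier ?R" "s = ?h x" using surj by blast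
    obtain t where t: "t \<in> carrier ?R" "x = (1 - zeta k) * t \<or> x = 1 + (1 - zeta k) * t"
      using residue_one_minus_zeta[OF k x(1)] by blast
    then have "s = ?h (1 - zeta k) \<otimes>\<^bsub>?S\<^esub> ?h t \<or> s = \<one>\<^bsub>?S\<^esub> \<oplus>\<^bsub>?S\<^esub> ?h (1 - zeta k) \<otimes>\<^bsub>?S\<^esub> ?h t"
      using x h.hom_mult[of "1 - zeta k" t] h.hom_add[of 1 "(1 - zeta k) * t"] h.hom_one by auto
    then show "\<exists>t\<in>carrier ?S. s = ?h (1 - zeta k) \<otimes>\<^bsub>?S\<^esub> t \<or> s = \<one>\<^bsub>?S\<^esub> \<oplus>\<^bsub>?S\<^esub> ?h (1 - zeta k) \<otimes>\<^bsub>?S\<^esub> t"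
      using h.hom_closed[OF t(1)] by blast
  next
    obtain t where t: "t \<in> carrier ?R" "(1 - zeta k) ^ (2 ^ (k - 1)) = t + t"
      using one_minus_zeta_power[OF k] by blast
    then have "?h (1 - zeta k) [^]\<^bsub>?S\<^esub> (2 ^ (k - 1) :: nat) = ?h t \<oplus>\<^bsub>?S\<^esub> ?h t"
      using h.hom_nat_pow[of "1 - zeta k" "2 ^ (k - 1)"] h.hom_add[of t t] by simp
    then show "\<exists>s\<in>carrier ?S. ?h (1 - zeta k) [^]\<^bsub>?S\<^esub> (2 ^ (k - 1) :: nat) = s \<oplus>\<^bsub>?S\<^esub> s"
      using h.hom_closed[OF t(1)] by blast
  qed
  then obtain K where K: "ideal K ?S" "card K = 2" by blast
  obtain J where J: "ideal J ?R" "I \<subseteq> J" "card (carrier (?R Quot J)) * 2 = card (carrier ?S)"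
    using I.quotient_ideal_contract[OF K(1) fin] K(2) by auto
  \<comment> \<open>\<open>J\<close> contains the nonzero ideal \<open>I\<close>, so its norm is its
    index and not the conventional 0.\<close>
  have "J \<noteq> {0}" using J(2) nz I.zero_closed by auto
  then have "m div 2 = ideal_norm ?R J" using J(3) card by (simp add: ideal_norm_def)
  then show ?thesis using J(1) by (auto simp: ideal_norms_def)
qed (use m in simp)

text \<open>The image of \<open>zeta k\<close> in the quotient has -1 as its power
  \<open>2 ^ (k - 1)\<close>, so the torsion count applies with \<open>j = k - 1\<close>.\<close>

lemma odd_ideal_norm_factor_cong_1:
  fixes u c :: nat
  assumes k: "k \<ge> 1" and m: "int (u * c) \<in> ideal_norms k" "odd (u * c)" and cop: "coprime u c"
  shows "[u = 1] (mod 2 ^ k)"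
proof -
  let ?R = "cyclotomic_ring k"
  obtain I where I: "ideal I ?R" "int (u * c) = ideal_norm ?R I" using m by (auto simp: ideal_norms_def)
  let ?S = "?R Quot I"
  interpret R: cring ?R by (rule cyclotomic_ring_cring)
  interpret I: ideal I ?R by (rule I)
  interpret S: cring ?S by (rule I.quotient_is_cring) (rule R.cring_axioms)
  interpret h: ring_hom_ring ?R ?S "(+>\<^bsub>?R\<^esub>) I" by (rule I.rcos_ring_hom_ring)
  have "u * c \<noteq> 0" using m(2) by (intro notI) simp
  then have "ideal_norm ?R I \<noteq> 0" using I(2) by linarith
  then have "int (u * c) = int (card (carrier ?S))"
    using I(2) by (auto simp: ideal_norm_def split: if_splits)
  then have card: "card (carrier ?S) = u * c" by linarith
  let ?z = "I +>\<^bsub>?R\<^esub> zeta k"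
  have "?z [^]\<^bsub>?S\<^esub> (2 ^ (k - 1) :: nat) = \<ominus>\<^bsub>?S\<^esub> \<one>\<^bsub>?S\<^esub>"
    using h.hom_nat_pow[of "zeta k" "2 ^ (k - 1)"] zeta_pow_half[OF k] h.hom_a_inv[of 1] h.hom_one by simp
  then have "[u = 1] (mod 2 ^ Suc (k - 1))"
    using S.card_torsion_cong_1[OF card cop m(2) h.hom_closed[of "zeta k"]] by simp
  then show ?thesis using k by simp
qed

section \<open>Sums of powers of two\<close>

text \<open>Positive exponents drop by one, and two ones merge into \<open>2 * 2 ^ 0\<close>;
  \<open>r\<close> records an unpaired one. The length bound counts it too.\<close>

lemma halve_sum_powers:
  fixes bs :: "nat list"
  shows "\<exists>bs' r. r \<in> {0, 1} \<and> length bs' + r \<le> length bs \<and>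
    (\<Sum>b\<leftarrow>bs. 2 ^ b :: int) = 2 * (\<Sum>b\<leftarrow>bs'. 2 ^ b) + int r"
proof (induction bs)
  case Nil
  show ?case by (rule exI[of _ "[]"], rule exI[of _ 0]) simp
next
  case (Cons b bs)
  then obtain bs' r where r: "r \<in> {0, 1}" "length bs' + r \<le> length bs"
    "(\<Sum>b\<leftarrow>bs. 2 ^ b :: int) = 2 * (\<Sum>b\<leftarrow>bs'. 2 ^ b) + int r" by blast
  consider c where "b = Suc c" | "b = 0" "r = 0" | "b = 0" "r = 1"
    using r(1) by (cases b) auto
  then show ?case
  proof cases
    case 1
    then show ?thesis using r by (intro exI[of _ "c # bs'"] exI[of _ r]) auto
  next
    case 2
    then show ?thesis using r by (intro exI[of _ bs'] exI[of _ 1]) auto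
  next
    case 3
    then show ?thesis using r by (intro exI[of _ "0 # bs'"] exI[of _ 0]) auto
  qed
qed

text \<open>For \<open>k > 0\<close> the sum is odd, so halving leaves an unpaired one; removing it
  gives one term fewer and a sum that is -1 modulo the next lower power of two. At
  \<open>k = 0\<close> the list is empty and 0 = \<open>2 ^ 0 - 1\<close>.\<close>

lemma sum_powers_eq_if_cong_minus_1:
  fixes bs :: "nat list"
  assumes "length bs \<le> k" "(2::int) ^ k dvd (\<Sum>b\<leftarrow>bs. 2 ^ b) + 1"
  shows "(\<Sum>b\<leftarrow>bs. 2 ^ b :: int) = 2 ^ k - 1"
  using assms
proof (induction k arbitrary: bs)
  case (Suc k)
  obtain bs' r where r: "r \<in> {0, 1}" "length bs' + r \<le> length bs"
    "(\<Sum>b\<leftarrow>bs. 2 ^ b :: int) = 2 * (\<Sum>b\<leftarrow>bs'. 2 ^ b) + int r"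
    using halve_sum_powers by blast
  have d: "2 * 2 ^ k dvd 2 * (\<Sum>b\<leftarrow>bs'. 2 ^ b :: int) + int r + 1" using Suc.prems(2) r(3) by simp
  then have "even (2 * (\<Sum>b\<leftarrow>bs'. 2 ^ b :: int) + int r + 1)" using dvd_mult_left by blast
  then have r1: "r = 1" using r(1) by auto
  then have "2 * 2 ^ k dvd 2 * ((\<Sum>b\<leftarrow>bs'. 2 ^ b :: int) + 1)" using d by (simp add: algebra_simps)
  then have "2 ^ k dvd (\<Sum>b\<leftarrow>bs'. 2 ^ b :: int) + 1"
    by (rule dvd_mult_cancel_left[THEN iffD1, THEN disjE]) simp_all
  then have "(\<Sum>b\<leftarrow>bs'. 2 ^ b :: int) = 2 ^ k - 1" using Suc.IH[of bs'] Suc.prems(1) r(2) r1 by simp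
  then show ?case using r(3) r1 by simp
qed simp

section \<open>Descent from \<open>2 * n\<close> to \<open>n\<close>\<close>

lemma ideal_norms_nonneg: "m \<in> ideal_norms k \<Longrightarrow> m \<ge> 0"
  by (auto simp: ideal_norms_def ideal_norm_def)

lemma norm_plus_powers_half:
  fixes n :: int
  assumes k: "k \<ge> 3" and n: "2 ^ (k - 1) * (2 ^ k - 1)\<^sup>2 dvd n"
    and rep: "norm_plus_powers k (2 * n)"
  shows "norm_plus_powers k n"
proof -
  obtain m bs where m: "m \<in> ideal_norms k" and bs: "length bs \<le> k"
    and e: "2 * n = m + (\<Sum>b\<leftarrow>bs. 2 ^ b)" using rep by (auto simp: norm_plus_powers_def)
  show ?thesis
  proof (cases "even m")
    case True
    obtain bs' r where r: "r \<in> {0, 1}" "length bs' + r \<le> length bs"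
      "(\<Sum>b\<leftarrow>bs. 2 ^ b :: int) = 2 * (\<Sum>b\<leftarrow>bs'. 2 ^ b) + int r"
      using halve_sum_powers by blast
    obtain m' where m': "m = 2 * m'" using True by blast
    have "r = 0 \<or> r = 1" using r(1) by blast
    \<comment> \<open>Both \<open>2 * n\<close> and \<open>m\<close> are even, so parity excludes
      \<open>r = 1\<close>.\<close>
    then have "n = m' + (\<Sum>b\<leftarrow>bs'. 2 ^ b)" using e r(3) m' by presburger
    moreover have "m' \<in> ideal_norms k" using even_ideal_norm_half[OF _ m True] m' k by simp
    moreover have "length bs' \<le> k" using r(2) bs by simp
    ultimately show ?thesis unfolding norm_plus_powers_def by blast
  next
    case False
    define u where "u = (2::nat) ^ k - 1"
    have u: "int u = 2 ^ k - 1" by (simp add: u_def of_nat_diff)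
    obtain w where w: "m = int w" using nonneg_int_cases[OF ideal_norms_nonneg[OF m]] .
    \<comment> \<open>The whole norm is taken as the factor, with cofactor 1.\<close>
    have "[w = 1] (mod 2 ^ k)"
      using odd_ideal_norm_factor_cong_1[of k w 1] k m w False by simp
    then have m1: "(2::int) ^ k dvd m - 1"
      using w by (metis cong_iff_dvd_diff cong_int_iff of_nat_1 of_nat_numeral of_nat_power)
    obtain q where q: "n = 2 ^ (k - 1) * (2 ^ k - 1)\<^sup>2 * q" using n by blast
    \<comment> \<open>The extra factor 2 of \<open>2 * n\<close> completes
      \<open>2 ^ (k - 1)\<close> to the modulus \<open>2 ^ k\<close>.\<close>
    have "(2::int) * 2 ^ (k - 1) = 2 ^ k" using k by (metis One_nat_def Suc_diff_1 less_le_trans power_Suc zero_less_numeral)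
    then have n2: "2 * n = 2 ^ k * (int u)\<^sup>2 * q" using q u by simp
    then have "2 ^ k dvd 2 * n - (m - 1)" using m1 by (simp add: dvd_diff)
    then have "2 ^ k dvd (\<Sum>b\<leftarrow>bs. 2 ^ b :: int) + 1" using e by simp
    then have "m = 2 * n - int u" using sum_powers_eq_if_cong_minus_1[OF bs] e u by simp
    \<comment> \<open>The square of \<open>u\<close> divides \<open>2 * n\<close>, so
      \<open>u\<close> splits off from \<open>2 * n - u\<close> and leaves a cofactor that is -1
      modulo \<open>u\<close>, hence coprime to \<open>u\<close>.\<close>
    then have fac: "m = int u * (int u * (2 ^ k * q) - 1)"
      using n2 by (simp add: power2_eq_square algebra_simps)
    define c where "c = nat (int u * (2 ^ k * q) - 1)"
    have upos: "int u > 0" using u k by simp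
    have "int u * (2 ^ k * q) - 1 \<ge> 0"
      using fac upos ideal_norms_nonneg[OF m] by (simp add: zero_le_mult_iff)
    then have c: "int c = int u * (2 ^ k * q) - 1" by (simp add: c_def)
    then have mc: "m = int (u * c)" using fac by simp
    have "coprime (int u) (int c)"
    proof (rule coprimeI)
      fix d assume "d dvd int u" "d dvd int c"
      then have "d dvd int u * (2 ^ k * q) - int c" by (intro dvd_diff) auto
      then show "is_unit d" using c by simp
    qed
    then have "coprime u c" by simp
    then have "[u = 1] (mod 2 ^ k)"
      using odd_ideal_norm_factor_cong_1[of k u c] k m False mc by simp
    then have "(2::int) ^ k dvd int u - 1"
      by (metis cong_iff_dvd_diff cong_int_iff of_nat_1 of_nat_numeral of_nat_power)
    \<comment> \<open>As \<open>u = 2 ^ k - 1\<close>, this difference is 2, too small for a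
      multiple of \<open>2 ^ k\<close>.\<close>
    then have "(2::int) ^ k dvd 2 ^ k - (int u - 1)" by (simp add: dvd_diff)
    then have "(2::int) ^ k dvd 2" using u by simp
    then have "(2::int) ^ k \<le> 2" by (rule zdvd_imp_le) simp
    moreover have "(2::int) ^ 3 \<le> 2 ^ k" using k by (intro power_increasing) auto
    ultimately show ?thesis by simp
  qed
qed

theorem lemma4:
  fixes k :: nat and n :: int
  assumes "k \<ge> 3"
    and "[n = 0] (mod 2 ^ (k - 1) * (2 ^ k - 1)\<^sup>2)"
    and "\<not> norm_plus_powers k n"
  shows "\<forall>a :: nat. \<not> norm_plus_powers k (2 ^ a * n)"
proof
  fix a :: nat
  show "\<not> norm_plus_powers k (2 ^ a * n)"
  proof (induction a)
    case (Suc a)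
    \<comment> \<open>The divisibility of \<open>n\<close> passes to \<open>2 ^ a * n\<close>, so
      the descent step is available at every stage of the induction.\<close>
    have "2 ^ (k - 1) * (2 ^ k - 1)\<^sup>2 dvd 2 ^ a * n" using assms(2) by (simp add: cong_0_iff)
    from norm_plus_powers_half[OF assms(1) this] show ?case using Suc by (auto simp: mult.assoc)
  qed (use assms(3) in simp)
qed

end
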